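(* The univariate equation $\Phi(\pi)=c$ has a unique solution $\pi^*$, and $\pi^*$ is the best (smallest) competitive ratio achievable for the online PMD problem by any online algorithm, deterministic or randomized: the algorithm \textsf{pCR-PMD}($\pi^*$) is feasible and has competitive ratio $\pi^*$, and no deterministic or randomized online algorithm has competitive ratio strictly smaller than $\pi^*$.
   Context: Fix a positive integer $T$, a storage capacity $c>0$, a per-slot discharge limit $\bar{\delta}\in(0,\infty]$, and demand bounds $0<\underline{d}\le\overline{d}$, with the standing assumption $c\le T\underline{d}$. Let $[T]=\{1,\dots,T\}$, $[a]^+=\max\{a,0\}$, and $\mathcal{D}=\{\bm x\in\mathbb{R}^T: \underline{d}\le x_t\le\overline{d}\ \forall t\in[T]\}$. For $\bm d\in\mathcal{D}$, the PMD problem is $\min_{\bm\delta\in\mathbb{R}^T}\max_{t\in[T]}(d_t-\delta_t)$ subject to $\sum_{t=1}^T\delta_t\le c$ and $0\le\delta_t\le\min\{\bar{\delta},d_t\}$ for all $t$; its optimal value is $v(\bm d)$. In the online setting demands are revealed one at a time and irrevocable decisions $\delta_t$ are made at each slot. A deterministic online algorithm $\mathfrak{C}$ produces, for each $\bm d\in\mathcal{D}$, a vector $\bm\delta(\mathfrak{C},\bm d)$ feasible for PMD with demand $\bm d$ such that $\delta_t(\mathfrak{C},\bm d)$ depends only on $d_1,\dots,d_t$; its competitive ratio is $\max_{\bm d\in\mathcal{D}}\max_{t}(d_t-\delta_t(\mathfrak{C},\bm d))/v(\bm d)$. A randomized online algorithm is a probability distribution over deterministic online algorithms, with competitive ratio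 defined using the expected peak in the numerator. For $\bm d\in\mathcal{D}$ and $t\in[T]$, let $\bm d^t=(d_1,\dots,d_t,\underline{d},\dots,\underline{d})$. For $\pi\ge1$, the online algorithm \textsf{pCR-PMD}($\pi$) discharges $\delta_t(\pi,\bm d)=[d_t-\pi v(\bm d^t)]^+$ at slot $t$, and $\Phi(\pi)=\max_{\bm d\in\mathcal{D}}\sum_{t=1}^T\delta_t(\pi,\bm d)$.
   Formalization: Two cases where the claim fails are excluded: c equal to T times the lower demand bound (ratio 0/0, or solution not unique, unless the next case applies), and c greater than T times the per-slot discharge limit (no solution with π at least 1). *)

theory Defs
  imports "HOL-Probability.Probability"
begin

text \<open>
  A vector of \<open>\<real>\<^sup>T\<close> is a function \<open>nat \<Rightarrow> real\<close> that is extensional on \<open>{1..T}\<close>. The parameters are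
  the number of slots \<open>T\<close>, the capacity \<open>c\<close>, the per-slot discharge limit \<open>db\<close> (an extended real,
  since it may be infinite) and the demand bounds \<open>dl\<close> and \<open>du\<close>.
  Minima and maxima over infinite sets are written \<open>Inf\<close> and \<open>Sup\<close>: the competitive ratio of an
  arbitrary online algorithm need not be attained by a worst-case demand.
\<close>

definition demands :: "nat \<Rightarrow> real \<Rightarrow> real \<Rightarrow> (nat \<Rightarrow> real) set" where
  "demands T dl du = {1..T} \<rightarrow>\<^sub>E {dl..du}"

definition feasible :: "nat \<Rightarrow> real \<Rightarrow> ereal \<Rightarrow> (nat \<Rightarrow> real) \<Rightarrow> (nat \<Rightarrow> real) set" where
  "feasible T c db d =
    {\<delta> \<in> extensional {1..T}. (\<Sum>t=1..T. \<delta> t) \<le> c \<and>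
       (\<forall>t\<in>{1..T}. 0 \<le> \<delta> t \<and> ereal (\<delta> t) \<le> min db (ereal (d t)))}"

definition peak :: "nat \<Rightarrow> (nat \<Rightarrow> real) \<Rightarrow> (nat \<Rightarrow> real) \<Rightarrow> real" where
  "peak T d \<delta> = Max ((\<lambda>t. d t - \<delta> t) ` {1..T})"

definition opt_val :: "nat \<Rightarrow> real \<Rightarrow> ereal \<Rightarrow> (nat \<Rightarrow> real) \<Rightarrow> real" where
  "opt_val T c db d = (INF \<delta>\<in>feasible T c db d. peak T d \<delta>)"

text \<open>
  A deterministic algorithm maps a demand vector to its vector of discharges; only its values on
  \<open>demands T dl du\<close> are relevant.
\<close>

type_synonym algorithm = "(nat \<Rightarrow> real) \<Rightarrow> nat \<Rightarrow> real"

definition online_algorithm ::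
  "nat \<Rightarrow> real \<Rightarrow> ereal \<Rightarrow> real \<Rightarrow> real \<Rightarrow> algorithm \<Rightarrow> bool" where
  "online_algorithm T c db dl du C \<longleftrightarrow>
    (\<forall>d\<in>demands T dl du. C d \<in> feasible T c db d) \<and>
    (\<forall>d\<in>demands T dl du. \<forall>d'\<in>demands T dl du. \<forall>t\<in>{1..T}.
       (\<forall>s\<in>{1..t}. d s = d' s) \<longrightarrow> C d t = C d' t)"

definition comp_ratio ::
  "nat \<Rightarrow> real \<Rightarrow> ereal \<Rightarrow> real \<Rightarrow> real \<Rightarrow> algorithm \<Rightarrow> real" where
  "comp_ratio T c db dl du C =
    (SUP d\<in>demands T dl du. peak T d (C d) / opt_val T c db d)"

text \<open>
  The \<open>\<sigma>\<close>-algebra on the set of deterministic online algorithms is arbitrary, subject only to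
  every single decision being a random variable, so that the expected peak makes sense.
\<close>

definition randomized_online_algorithm ::
  "nat \<Rightarrow> real \<Rightarrow> ereal \<Rightarrow> real \<Rightarrow> real \<Rightarrow> algorithm measure \<Rightarrow> bool" where
  "randomized_online_algorithm T c db dl du M \<longleftrightarrow>
    prob_space M \<and>
    space M \<subseteq> {C. online_algorithm T c db dl du C} \<and>
    (\<forall>d\<in>demands T dl du. \<forall>t\<in>{1..T}. (\<lambda>C. C d t) \<in> borel_measurable M)"

definition randomized_comp_ratio ::
  "nat \<Rightarrow> real \<Rightarrow> ereal \<Rightarrow> real \<Rightarrow> real \<Rightarrow> algorithm measure \<Rightarrow> real" where
  "randomized_comp_ratio T c db dl du M =
    (SUP d\<in>demands T dl du. (\<integral>C. peak T d (C d) \<partial>M) / opt_val T c db d)"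

definition truncated_demand :: "nat \<Rightarrow> real \<Rightarrow> (nat \<Rightarrow> real) \<Rightarrow> nat \<Rightarrow> nat \<Rightarrow> real" where
  "truncated_demand T dl d t = (\<lambda>s\<in>{1..T}. if s \<le> t then d s else dl)"

definition pCR_PMD :: "nat \<Rightarrow> real \<Rightarrow> ereal \<Rightarrow> real \<Rightarrow> real \<Rightarrow> algorithm" where
  "pCR_PMD T c db dl \<pi> d =
    (\<lambda>t\<in>{1..T}. max (d t - \<pi> * opt_val T c db (truncated_demand T dl d t)) 0)"

definition Phi :: "nat \<Rightarrow> real \<Rightarrow> ereal \<Rightarrow> real \<Rightarrow> real \<Rightarrow> real \<Rightarrow> real" where
  "Phi T c db dl du \<pi> = (SUP d\<in>demands T dl du. \<Sum>t=1..T. pCR_PMD T c db dl \<pi> d t)"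

text \<open>
  Two degenerate parameter regimes have to be excluded by further hypotheses.
  If \<open>c = T * dl\<close> (and \<open>db \<ge> dl\<close>), the optimal value at the constant demand \<open>dl\<close> is 0, so the
  competitive ratio is undefined there and \<open>Phi\<close> equals \<open>c\<close> for all large \<open>\<pi>\<close>.
  If \<open>T * db < c\<close>, the capacity can never be exhausted and \<open>Phi \<pi> \<le> T * db < c\<close> for all
  \<open>\<pi> \<ge> 1\<close>, so \<open>Phi \<pi> = c\<close> has no solution.
\<close>

definition pmd_parameters :: "nat \<Rightarrow> real \<Rightarrow> ereal \<Rightarrow> real \<Rightarrow> real \<Rightarrow> bool" where
  "pmd_parameters T c db dl du \<longleftrightarrow>
    1 \<le> T \<and> 0 < c \<and> 0 < db \<and> 0 < dl \<and> dl \<le> du \<and> c \<le> real T * dl"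

end

theory Submission
  imports Defs
begin

text \<open>
  Write \<open>v t\<close> for the optimal value at the demand truncated after slot \<open>t\<close>. Against the truncated demand,
  a \<open>\<pi>\<close>-competitive online algorithm must already leave at most \<open>\<pi> * v t\<close> in slot \<open>t\<close>; hence it
  discharges at least as much as \<open>pCR_PMD\<close> in every slot, and \<open>Phi \<pi> \<le> c\<close>. Averaging the decisions of a
  randomized algorithm gives a deterministic one whose ratio is no larger, since the peak is convex.
  Optimal values lie between \<open>dl - c / T > 0\<close> and \<open>du\<close>, so \<open>Phi\<close> is Lipschitz and, where it is positive,
  strictly decreasing. Finally \<open>Phi 1 \<ge> c\<close>, as the constant demand \<open>dl\<close> shows, and \<open>Phi\<close> vanishes
  for large arguments.
\<close>

section \<open>Peaks, feasible discharges and demands\<close>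

lemma diff_le_peak: "t \<in> {1..T} \<Longrightarrow> d t - \<delta> t \<le> peak T d \<delta>"
  unfolding peak_def by (rule Max_ge) auto

lemma peak_le_iff: "1 \<le> T \<Longrightarrow> peak T d \<delta> \<le> y \<longleftrightarrow> (\<forall>t\<in>{1..T}. d t - \<delta> t \<le> y)"
  unfolding peak_def by (subst Max_le_iff) auto

lemma feasible_nonneg: "\<delta> \<in> feasible T c db d \<Longrightarrow> t \<in> {1..T} \<Longrightarrow> 0 \<le> \<delta> t"
  by (auto simp: feasible_def)

lemma feasible_le_demand: "\<delta> \<in> feasible T c db d \<Longrightarrow> t \<in> {1..T} \<Longrightarrow> \<delta> t \<le> d t"
  by (auto simp: feasible_def)

lemma peak_nonneg:
  assumes "1 \<le> T" "\<delta> \<in> feasible T c db d"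
  shows "0 \<le> peak T d \<delta>"
  using diff_le_peak[of 1 T d \<delta>] feasible_le_demand[OF assms(2), of 1] assms(1) by auto

lemma demandsD: "d \<in> demands T dl du \<Longrightarrow> t \<in> {1..T} \<Longrightarrow> dl \<le> d t \<and> d t \<le> du"
  by (auto simp: demands_def)

text \<open>\<open>c_less\<close> makes every optimal value positive, so competitive ratios are well
  defined; \<open>c_le_db\<close> lets the capacity be spread evenly over the slots within the
  discharge limit.\<close>

locale pmd =
  fixes T :: nat and c dl du :: real and db :: ereal
  assumes T_pos: "1 \<le> T" and c_pos: "0 < c" and db_pos: "0 < db" and dl_pos: "0 < dl"
    and dl_le_du: "dl \<le> du" and c_less: "c < real T * dl"
    and c_le_db: "ereal c \<le> ereal (real T) * db"
begin

abbreviation D where "D \<equiv> demands T dl du"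
abbreviation F where "F \<equiv> feasible T c db"
abbreviation v where "v \<equiv> opt_val T c db"
abbreviation trunc where "trunc \<equiv> truncated_demand T dl"
abbreviation alg where "alg \<equiv> pCR_PMD T c db dl"
abbreviation \<Phi> where "\<Phi> \<equiv> Phi T c db dl du"
abbreviation online where "online \<equiv> online_algorithm T c db dl du"

text \<open>Spreading the capacity evenly over the constant demand \<open>dl\<close> leaves this
  peak. By \<open>opt_val_ge\<close> and \<open>opt_val_const_le\<close> it is the least optimal
  value on \<open>D\<close>.\<close>

definition v_low :: real where "v_low = dl - c / real T"

lemma v_low_pos: "0 < v_low"
  using c_less T_pos by (simp add: v_low_def field_simps)

lemma const_in_demands: "(\<lambda>t\<in>{1..T}. dl) \<in> D"
  using dl_le_du by (auto simp: demands_def)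

lemma trunc_in_demands: "d \<in> D \<Longrightarrow> trunc d t \<in> D"
  using dl_le_du by (auto simp: demands_def truncated_demand_def PiE_iff)

lemma trunc_le: "d \<in> D \<Longrightarrow> s \<in> {1..T} \<Longrightarrow> trunc d t s \<le> d s"
  by (auto simp: demands_def truncated_demand_def)

lemma trunc_eq: "s \<in> {1..T} \<Longrightarrow> s \<le> t \<Longrightarrow> trunc d t s = d s"
  by (auto simp: truncated_demand_def)

section \<open>Bounds and monotonicity of the optimal value\<close>

lemma zero_feasible:
  assumes "d \<in> D"
  shows "(\<lambda>t\<in>{1..T}. 0) \<in> F d"
proof -
  have "0 \<le> d t" if "t \<in> {1..T}" for t
    using demandsD[OF assms that] dl_pos by linarith
  then show ?thesis
    using c_pos db_pos by (auto simp: feasible_def zero_ereal_def[symmetric])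
qed

lemma opt_val_le_peak: "\<delta> \<in> F d \<Longrightarrow> v d \<le> peak T d \<delta>"
  unfolding opt_val_def
  by (rule cINF_lower) (auto intro!: bdd_belowI[of _ 0] peak_nonneg[OF T_pos])

lemma le_opt_val:
  assumes "d \<in> D" "\<And>\<delta>. \<delta> \<in> F d \<Longrightarrow> y \<le> peak T d \<delta>"
  shows "y \<le> v d"
  unfolding opt_val_def using zero_feasible[OF assms(1)] assms(2)
  by (intro cINF_greatest) auto

lemma opt_val_le:
  assumes "d \<in> D"
  shows "v d \<le> du"
proof -
  have "peak T d (\<lambda>t\<in>{1..T}. 0) \<le> du"
    using demandsD[OF assms] T_pos by (auto simp: peak_le_iff)
  with opt_val_le_peak[OF zero_feasible[OF assms]] show ?thesis
    by linarith
qed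

text \<open>The peak is at least the average remainder; the average demand is at least
  \<open>dl\<close>, and the capacity lowers it by at most \<open>c / real T\<close>.\<close>

lemma opt_val_ge:
  assumes "d \<in> D"
  shows "v_low \<le> v d"
proof (rule le_opt_val[OF assms])
  fix \<delta> assume \<delta>: "\<delta> \<in> F d"
  have "real T * dl - c \<le> (\<Sum>t=1..T. dl) - (\<Sum>t=1..T. \<delta> t)"
    using \<delta> by (simp add: feasible_def)
  also have "\<dots> = (\<Sum>t=1..T. dl - \<delta> t)"
    by (simp add: sum_subtractf)
  also have "\<dots> \<le> (\<Sum>t=1..T. peak T d \<delta>)"
  proof (rule sum_mono)
    fix t assume t: "t \<in> {1..T}"
    show "dl - \<delta> t \<le> peak T d \<delta>"
      using diff_le_peak[OF t, of d \<delta>] demandsD[OF assms t] by linarith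
  qed
  also have "\<dots> = real T * peak T d \<delta>"
    by simp
  finally show "v_low \<le> peak T d \<delta>"
    using T_pos by (simp add: v_low_def field_simps)
qed

lemma opt_val_pos: "d \<in> D \<Longrightarrow> 0 < v d"
  using opt_val_ge v_low_pos by fastforce

text \<open>For a finite limit \<open>r\<close>, every feasible discharge leaves at least
  \<open>d t - r\<close> in slot \<open>t\<close>. This keeps \<open>pCR_PMD\<close> within the
  limit.\<close>

lemma demand_minus_opt_val_le:
  assumes "d \<in> D" "t \<in> {1..T}"
  shows "ereal (d t - v d) \<le> db"
proof (cases db)
  case (real r)
  have "d t - r \<le> v d"
  proof (rule le_opt_val[OF assms(1)])
    fix \<delta> assume "\<delta> \<in> F d"
    then have "\<delta> t \<le> r"
      using assms(2) real by (auto simp: feasible_def)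
    then show "d t - r \<le> peak T d \<delta>"
      using diff_le_peak[OF assms(2), of d \<delta>] by linarith
  qed
  then show ?thesis
    by (simp add: real)
qed (use db_pos in auto)

text \<open>A discharge for the larger demand, capped at the smaller one, stays feasible: a capped
  slot keeps remainder 0, any other slot no more than before.\<close>

lemma opt_val_mono:
  assumes "d \<in> D" "d' \<in> D" "\<And>t. t \<in> {1..T} \<Longrightarrow> d t \<le> d' t"
  shows "v d \<le> v d'"
proof (rule le_opt_val[OF assms(2)])
  fix \<delta> assume \<delta>: "\<delta> \<in> F d'"
  define \<epsilon> where "\<epsilon> = (\<lambda>t\<in>{1..T}. min (\<delta> t) (d t))"
  have "\<epsilon> \<in> F d"
    unfolding feasible_def
  proof (intro CollectI conjI ballI)
    show "(\<Sum>t=1..T. \<epsilon> t) \<le> c"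
    proof -
      have "(\<Sum>t=1..T. \<epsilon> t) \<le> (\<Sum>t=1..T. \<delta> t)"
        by (intro sum_mono) (auto simp: \<epsilon>_def)
      also have "\<dots> \<le> c"
        using \<delta> by (simp add: feasible_def)
      finally show ?thesis .
    qed
  next
    fix t assume t: "t \<in> {1..T}"
    show "0 \<le> \<epsilon> t"
      using feasible_nonneg[OF \<delta> t] demandsD[OF assms(1) t] dl_pos t by (simp add: \<epsilon>_def)
    have "ereal (\<epsilon> t) \<le> ereal (\<delta> t)"
      using t by (simp add: \<epsilon>_def)
    also have "\<dots> \<le> db"
      using \<delta> t by (auto simp: feasible_def)
    finally show "ereal (\<epsilon> t) \<le> min db (ereal (d t))"
      using t by (simp add: \<epsilon>_def)
  qed (simp add: \<epsilon>_def)
  moreover have "peak T d \<epsilon> \<le> peak T d' \<delta>"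
    unfolding peak_le_iff[OF T_pos]
  proof
    fix t assume t: "t \<in> {1..T}"
    show "d t - \<epsilon> t \<le> peak T d' \<delta>"
      using diff_le_peak[OF t, of d' \<delta>] assms(3)[OF t] peak_nonneg[OF T_pos \<delta>] t
      by (auto simp: \<epsilon>_def min_def)
  qed
  ultimately show "v d \<le> peak T d' \<delta>"
    using opt_val_le_peak by fastforce
qed

lemma opt_val_trunc_le: "d \<in> D \<Longrightarrow> v (trunc d t) \<le> v d"
  by (intro opt_val_mono trunc_in_demands trunc_le)

lemma opt_val_const_le: "v (\<lambda>t\<in>{1..T}. dl) \<le> v_low"
proof -
  let ?\<delta> = "\<lambda>t\<in>{1..T}. c / real T"
  have "ereal (c / real T) \<le> db"
    using c_le_db db_pos T_pos by (cases db) (auto simp: field_simps)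
  moreover have "c / real T \<le> dl"
    using v_low_pos by (simp add: v_low_def)
  ultimately have "?\<delta> \<in> F (\<lambda>t\<in>{1..T}. dl)"
    using T_pos c_pos by (auto simp: feasible_def)
  then have "v (\<lambda>t\<in>{1..T}. dl) \<le> peak T (\<lambda>t\<in>{1..T}. dl) ?\<delta>"
    by (rule opt_val_le_peak)
  also have "\<dots> \<le> v_low"
    unfolding peak_le_iff[OF T_pos] by (simp add: v_low_def)
  finally show ?thesis .
qed

section \<open>The total discharge as a function of the ratio\<close>

lemma pCR_PMD_eq:
  "t \<in> {1..T} \<Longrightarrow> alg \<pi> d t = max (d t - \<pi> * v (trunc d t)) 0"
  by (simp add: pCR_PMD_def)

text \<open>The positive part is 1-Lipschitz, and since optimal values are positive and at most
  \<open>du\<close>, the threshold moves by at most \<open>du\<close> times the change of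
  ratio.\<close>

lemma pCR_PMD_lipschitz:
  assumes "d \<in> D" "t \<in> {1..T}"
  shows "alg \<pi> d t \<le> alg \<pi>' d t + \<bar>\<pi> - \<pi>'\<bar> * du"
proof -
  have "(\<pi>' - \<pi>) * v (trunc d t) \<le> \<bar>\<pi> - \<pi>'\<bar> * v (trunc d t)"
    using opt_val_pos[OF trunc_in_demands[OF assms(1)], of t] by (intro mult_right_mono) auto
  also have "\<dots> \<le> \<bar>\<pi> - \<pi>'\<bar> * du"
    using opt_val_le[OF trunc_in_demands[OF assms(1)], of t] by (intro mult_left_mono) auto
  finally have "\<pi>' * v (trunc d t) - \<pi> * v (trunc d t) \<le> \<bar>\<pi> - \<pi>'\<bar> * du"
    by (simp add: left_diff_distrib)
  moreover have "0 \<le> \<bar>\<pi> - \<pi>'\<bar> * du"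
    using dl_pos dl_le_du by simp
  ultimately show ?thesis
    using assms(2) by (simp add: pCR_PMD_eq)
qed

lemma sum_pCR_PMD_lipschitz:
  assumes "d \<in> D"
  shows "(\<Sum>t=1..T. alg \<pi> d t) \<le> (\<Sum>t=1..T. alg \<pi>' d t) + real T * du * \<bar>\<pi> - \<pi>'\<bar>"
proof -
  have "(\<Sum>t=1..T. alg \<pi> d t) \<le> (\<Sum>t=1..T. alg \<pi>' d t + \<bar>\<pi> - \<pi>'\<bar> * du)"
    by (intro sum_mono pCR_PMD_lipschitz assms)
  then show ?thesis
    by (simp add: sum.distrib mult_ac)
qed

lemma bdd_above_sum_pCR_PMD: "bdd_above ((\<lambda>d. \<Sum>t=1..T. alg \<pi> d t) ` D)"
proof (rule bdd_aboveI2)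
  fix d assume d: "d \<in> D"
  \<comment> \<open>Ratio 0 serves as reference, since there each discharge is the whole demand; the
    Lipschitz estimate carries the bound over to \<open>\<pi>\<close>.\<close>
  have "(\<Sum>t=1..T. alg 0 d t) \<le> (\<Sum>t=1..T. du)"
  proof (rule sum_mono)
    fix t assume t: "t \<in> {1..T}"
    show "alg 0 d t \<le> du"
      using demandsD[OF d t] dl_pos dl_le_du t by (simp add: pCR_PMD_eq)
  qed
  with sum_pCR_PMD_lipschitz[OF d, of \<pi> 0]
  show "(\<Sum>t=1..T. alg \<pi> d t) \<le> real T * du + real T * du * \<bar>\<pi>\<bar>"
    by simp
qed

lemma sum_pCR_PMD_le_Phi: "d \<in> D \<Longrightarrow> (\<Sum>t=1..T. alg \<pi> d t) \<le> \<Phi> \<pi>"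
  unfolding Phi_def by (rule cSUP_upper[OF _ bdd_above_sum_pCR_PMD])

lemma Phi_le: "(\<And>d. d \<in> D \<Longrightarrow> (\<Sum>t=1..T. alg \<pi> d t) \<le> y) \<Longrightarrow> \<Phi> \<pi> \<le> y"
  unfolding Phi_def using const_in_demands by (intro cSUP_least) auto

text \<open>A supremum of functions with a common Lipschitz constant inherits it. This supplies the
  continuity for the intermediate value theorem.\<close>

lemma Phi_lipschitz: "(real T * du)-lipschitz_on UNIV \<Phi>"
proof (rule lipschitz_onI)
  have *: "\<Phi> \<pi> \<le> \<Phi> \<pi>' + real T * du * \<bar>\<pi> - \<pi>'\<bar>" for \<pi> \<pi>'
    using sum_pCR_PMD_lipschitz[of _ \<pi> \<pi>'] sum_pCR_PMD_le_Phi[of _ \<pi>']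
    by (intro Phi_le) fastforce
  show "dist (\<Phi> \<pi>) (\<Phi> \<pi>') \<le> real T * du * dist \<pi> \<pi>'" for \<pi> \<pi>'
    using *[of \<pi> \<pi>'] *[of \<pi>' \<pi>] by (simp add: dist_real_def abs_minus_commute)
qed (use dl_pos dl_le_du in simp)

text \<open>Strict decrease of each sum alone could be lost in the supremum. The gain
  \<open>(\<pi> - \<pi>') * v_low\<close> in a slot that discharges under \<open>\<pi>\<close> is
  uniform in the demand, so it survives.\<close>

lemma Phi_less:
  assumes "\<pi>' < \<pi>" "0 < \<Phi> \<pi>"
  shows "\<Phi> \<pi> < \<Phi> \<pi>'"
proof -
  have gain: "alg \<pi> d t + (if 0 < alg \<pi> d t then (\<pi> - \<pi>') * v_low else 0) \<le> alg \<pi>' d t"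
    if "d \<in> D" "t \<in> {1..T}" for d t
  proof -
    have "(\<pi> - \<pi>') * v_low \<le> (\<pi> - \<pi>') * v (trunc d t)"
      using assms(1) opt_val_ge[OF trunc_in_demands[OF that(1)]] by (intro mult_left_mono) auto
    then show ?thesis
      using that(2) by (auto simp: pCR_PMD_eq left_diff_distrib max_def)
  qed
  have gap: "0 < (\<pi> - \<pi>') * v_low"
    using assms(1) v_low_pos by simp
  \<comment> \<open>The alternative 0 covers demands on which \<open>alg \<pi>\<close> discharges
    nothing; positivity of \<open>\<Phi> \<pi>\<close> then leaves only the other one.\<close>
  have "\<Phi> \<pi> \<le> max 0 (\<Phi> \<pi>' - (\<pi> - \<pi>') * v_low)"
  proof (rule Phi_le)
    fix d assume d: "d \<in> D"
    show "(\<Sum>t=1..T. alg \<pi> d t) \<le> max 0 (\<Phi> \<pi>' - (\<pi> - \<pi>') * v_low)"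
    proof (cases "\<exists>t\<in>{1..T}. 0 < alg \<pi> d t")
      case True
      then obtain s where s: "s \<in> {1..T}" "0 < alg \<pi> d s"
        by blast
      have "(\<pi> - \<pi>') * v_low \<le> (\<Sum>t=1..T. if 0 < alg \<pi> d t then (\<pi> - \<pi>') * v_low else 0)"
        using member_le_sum[of s "{1..T}" "\<lambda>t. if 0 < alg \<pi> d t then (\<pi> - \<pi>') * v_low else 0"]
          s gap by simp
      moreover have "(\<Sum>t=1..T. alg \<pi> d t + (if 0 < alg \<pi> d t then (\<pi> - \<pi>') * v_low else 0))
          \<le> (\<Sum>t=1..T. alg \<pi>' d t)"
        by (intro sum_mono gain d)
      ultimately show ?thesis
        using sum_pCR_PMD_le_Phi[OF d, of \<pi>'] by (simp add: sum.distrib)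
    next
      case False
      then have "(\<Sum>t=1..T. alg \<pi> d t) \<le> 0"
        by (intro sum_nonpos) (auto simp: not_less)
      then show ?thesis
        by simp
    qed
  qed
  with gap assms(2) show ?thesis
    by linarith
qed

text \<open>The constant demand \<open>dl\<close> equals all its truncations and has optimal value
  at most \<open>v_low\<close>, so ratio 1 discharges at least \<open>c / real T\<close> in every
  slot.\<close>

lemma Phi_1_ge: "c \<le> \<Phi> 1"
proof -
  let ?d = "\<lambda>t\<in>{1..T}. dl"
  have "trunc ?d t = ?d" for t
    by (auto simp: truncated_demand_def)
  then have "c / real T \<le> alg 1 ?d t" if "t \<in> {1..T}" for t
    using opt_val_const_le that by (simp add: pCR_PMD_eq v_low_def)
  then have "(\<Sum>t=1..T. c / real T) \<le> (\<Sum>t=1..T. alg 1 ?d t)"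
    by (intro sum_mono)
  also have "\<dots> \<le> \<Phi> 1"
    by (rule sum_pCR_PMD_le_Phi[OF const_in_demands])
  finally show ?thesis
    using T_pos by simp
qed

lemma Phi_large: "\<Phi> (du / v_low) \<le> 0"
proof (intro Phi_le sum_nonpos)
  fix d t assume d: "d \<in> D" and t: "t \<in> {1..T}"
  have "du / v_low * v_low \<le> du / v_low * v (trunc d t)"
    using opt_val_ge[OF trunc_in_demands[OF d]] v_low_pos dl_pos dl_le_du
    by (intro mult_left_mono) auto
  then show "alg (du / v_low) d t \<le> 0"
    using demandsD[OF d t] t v_low_pos by (simp add: pCR_PMD_eq)
qed

text \<open>On \<open>{1..du / v_low}\<close> the continuous \<open>\<Phi>\<close> falls from at
  least \<open>c\<close> to at most 0, which gives existence. Uniqueness follows from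
  \<open>Phi_less\<close>, as \<open>c\<close> is positive.\<close>

lemma ex1_Phi_eq: "\<exists>!\<pi>. 1 \<le> \<pi> \<and> \<Phi> \<pi> = c"
proof -
  have "c / real T > 0"
    using c_pos T_pos by simp
  then have "1 \<le> du / v_low"
    using v_low_pos dl_le_du by (simp add: v_low_def)
  moreover have "continuous_on {1..du / v_low} \<Phi>"
    using lipschitz_on_continuous_on[OF Phi_lipschitz] continuous_on_subset by blast
  ultimately obtain \<pi> where "1 \<le> \<pi>" "\<Phi> \<pi> = c"
    using IVT2'[of \<Phi> "du / v_low" c 1] Phi_1_ge Phi_large c_pos by auto
  moreover have "\<pi>' = \<pi>" if "\<Phi> \<pi>' = c" "\<Phi> \<pi> = c" for \<pi> \<pi>'
    using Phi_less[of \<pi> \<pi>'] Phi_less[of \<pi>' \<pi>] that c_pos by (cases \<pi> \<pi>' rule: linorder_cases) auto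
  ultimately show ?thesis
    by blast
qed

section \<open>Feasibility and ratio of \<open>pCR_PMD\<close>\<close>

lemma online_pCR_PMD:
  assumes "1 \<le> \<pi>" "\<Phi> \<pi> = c"
  shows "online (alg \<pi>)"
  unfolding online_algorithm_def
proof (intro conjI ballI impI)
  fix d assume d: "d \<in> D"
  show "alg \<pi> d \<in> F d"
    unfolding feasible_def
  proof (intro CollectI conjI ballI)
    show "alg \<pi> d \<in> extensional {1..T}"
      by (simp add: pCR_PMD_def)
    show "(\<Sum>t=1..T. alg \<pi> d t) \<le> c"
      using sum_pCR_PMD_le_Phi[OF d, of \<pi>] assms(2) by simp
  next
    fix t assume t: "t \<in> {1..T}"
    let ?v = "v (trunc d t)"
    show "0 \<le> alg \<pi> d t"
      using t by (simp add: pCR_PMD_eq)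
    have v: "0 < ?v"
      by (rule opt_val_pos[OF trunc_in_demands[OF d]])
    \<comment> \<open>A ratio of at least 1 discharges no more than ratio 1 would, and
      \<open>max (d t - ?v) 0\<close> obeys both the demand bound and the slot limit.\<close>
    with assms(1) have "?v \<le> \<pi> * ?v"
      using mult_right_mono[of 1 \<pi> ?v] by simp
    then have le: "alg \<pi> d t \<le> max (d t - ?v) 0"
      unfolding pCR_PMD_eq[OF t] by linarith
    then have "alg \<pi> d t \<le> d t"
      using v demandsD[OF d t] dl_pos by linarith
    moreover have "ereal (alg \<pi> d t) \<le> db"
    proof -
      have "ereal (alg \<pi> d t) \<le> max (ereal (d t - ?v)) 0"
        using le by (metis ereal_less_eq(3) ereal_max_0 max.commute)
      also have "\<dots> \<le> db"
        using demand_minus_opt_val_le[OF trunc_in_demands[OF d] t, of t] db_pos t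
        by (simp add: trunc_eq)
      finally show ?thesis .
    qed
    ultimately show "ereal (alg \<pi> d t) \<le> min db (ereal (d t))"
      by simp
  qed
next
  fix d d' :: "nat \<Rightarrow> real" and t
  assume t: "t \<in> {1..T}" and eq: "\<forall>s\<in>{1..t}. d s = d' s"
  have "trunc d t = trunc d' t"
    unfolding truncated_demand_def using eq by (intro restrict_ext) simp
  moreover have "d t = d' t"
    using eq t by simp
  ultimately show "alg \<pi> d t = alg \<pi> d' t"
    by (simp only: pCR_PMD_eq[OF t])
qed

text \<open>Slot \<open>t\<close> retains at most its threshold, computed from the truncated demand,
  whose optimal value cannot exceed that of \<open>d\<close>.\<close>

lemma peak_pCR_PMD_le:
  assumes "0 \<le> \<pi>" "d \<in> D"
  shows "peak T d (alg \<pi> d) \<le> \<pi> * v d"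
  unfolding peak_le_iff[OF T_pos]
proof
  fix t assume t: "t \<in> {1..T}"
  have "\<pi> * v (trunc d t) \<le> \<pi> * v d"
    using assms by (intro mult_left_mono opt_val_trunc_le)
  then show "d t - alg \<pi> d t \<le> \<pi> * v d"
    using t by (simp add: pCR_PMD_eq)
qed

lemma comp_ratio_pCR_PMD_le:
  assumes "0 \<le> \<pi>"
  shows "comp_ratio T c db dl du (alg \<pi>) \<le> \<pi>"
  unfolding comp_ratio_def
  using const_in_demands peak_pCR_PMD_le[OF assms] opt_val_pos
  by (intro cSUP_least) (auto simp: field_simps)

section \<open>Discharges forced by a competitive guarantee\<close>

lemma Phi_le_capacity:
  assumes "online C" "\<And>d. d \<in> D \<Longrightarrow> peak T d (C d) \<le> \<pi> * v d"
  shows "\<Phi> \<pi> \<le> c"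
proof (rule Phi_le)
  fix d assume d: "d \<in> D"
  have feas: "C d \<in> F d"
    using assms(1) d by (simp add: online_algorithm_def)
  have "(\<Sum>t=1..T. alg \<pi> d t) \<le> (\<Sum>t=1..T. C d t)"
  proof (rule sum_mono)
    fix t assume t: "t \<in> {1..T}"
    have d': "trunc d t \<in> D"
      using d by (rule trunc_in_demands)
    \<comment> \<open>Through slot \<open>t\<close> the algorithm cannot tell \<open>d\<close> from
      its truncation, so the guarantee for the truncated demand constrains the actual decision in
      slot \<open>t\<close>.\<close>
    have "\<forall>s\<in>{1..t}. trunc d t s = d s"
      using t by (auto simp: truncated_demand_def)
    then have "C (trunc d t) t = C d t"
      using assms(1) d d' t unfolding online_algorithm_def by blast
    then have "d t - C d t \<le> \<pi> * v (trunc d t)"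
      using diff_le_peak[OF t, of "trunc d t" "C (trunc d t)"] assms(2)[OF d'] t
      by (simp add: trunc_eq)
    then show "alg \<pi> d t \<le> C d t"
      using feasible_nonneg[OF feas t] t by (simp add: pCR_PMD_eq)
  qed
  also have "\<dots> \<le> c"
    using feas by (simp add: feasible_def)
  finally show "(\<Sum>t=1..T. alg \<pi> d t) \<le> c" .
qed

section \<open>Averaging a randomized algorithm\<close>

context
  fixes M :: "algorithm measure"
  assumes M: "randomized_online_algorithm T c db dl du M"
begin

interpretation prob_space M
  using M by (simp add: randomized_online_algorithm_def)

lemma random_feasible: "C \<in> space M \<Longrightarrow> d \<in> D \<Longrightarrow> C d \<in> F d"
  using M by (auto simp: randomized_online_algorithm_def online_algorithm_def)

lemma random_decision_measurable:
  "d \<in> D \<Longrightarrow> t \<in> {1..T} \<Longrightarrow> (\<lambda>C. C d t) \<in> borel_measurable M"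
  using M by (auto simp: randomized_online_algorithm_def)

lemma integrable_decision:
  assumes "d \<in> D" "t \<in> {1..T}"
  shows "integrable M (\<lambda>C. C d t)"
proof (rule integrable_const_bound[of _ "d t"])
  show "AE C in M. norm (C d t) \<le> d t"
    using feasible_nonneg[OF random_feasible[OF _ assms(1)] assms(2)]
      feasible_le_demand[OF random_feasible[OF _ assms(1)] assms(2)]
    by (intro AE_I2) simp
qed (rule random_decision_measurable[OF assms])

lemma random_peak_bounds:
  assumes "C \<in> space M" "d \<in> D"
  shows "0 \<le> peak T d (C d)" "peak T d (C d) \<le> du"
proof -
  note feas = random_feasible[OF assms]
  show "0 \<le> peak T d (C d)"
    by (rule peak_nonneg[OF T_pos feas])
  show "peak T d (C d) \<le> du"
    unfolding peak_le_iff[OF T_pos]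
    using feasible_nonneg[OF feas] demandsD[OF assms(2)] by fastforce
qed

lemma integrable_peak:
  assumes "d \<in> D"
  shows "integrable M (\<lambda>C. peak T d (C d))"
proof (rule integrable_const_bound[of _ du])
  show "AE C in M. norm (peak T d (C d)) \<le> du"
    using random_peak_bounds[OF _ assms] by (intro AE_I2) simp
  show "(\<lambda>C. peak T d (C d)) \<in> borel_measurable M"
    unfolding peak_def using T_pos random_decision_measurable[OF assms]
    by (intro borel_measurable_Max borel_measurable_diff) auto
qed

definition average :: algorithm where
  "average d = (\<lambda>t\<in>{1..T}. \<integral>C. C d t \<partial>M)"

text \<open>Every feasibility constraint is linear in the discharge, so expectation preserves it.
  Equal pasts give equal decisions for each \<open>C\<close> in the space, hence equal
  integrals.\<close>

lemma online_average: "online average"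
  unfolding online_algorithm_def
proof (intro conjI ballI impI)
  fix d assume d: "d \<in> D"
  show "average d \<in> F d"
    unfolding feasible_def
  proof (intro CollectI conjI ballI)
    show "average d \<in> extensional {1..T}"
      by (simp add: average_def)
    have "(\<Sum>t=1..T. average d t) = (\<integral>C. (\<Sum>t=1..T. C d t) \<partial>M)"
      using integrable_decision[OF d] by (simp add: average_def)
    also have "\<dots> \<le> c"
      using integrable_decision[OF d] random_feasible[OF _ d]
      by (intro integral_le_const AE_I2) (auto simp: feasible_def)
    finally show "(\<Sum>t=1..T. average d t) \<le> c" .
  next
    fix t assume t: "t \<in> {1..T}"
    note int = integrable_decision[OF d t]
    show "0 \<le> average d t"
      using feasible_nonneg[OF random_feasible[OF _ d] t] t
      by (simp add: average_def integral_nonneg_AE)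
    have "average d t \<le> d t"
      using feasible_le_demand[OF random_feasible[OF _ d] t] t
      by (simp add: average_def) (intro integral_le_const int AE_I2)
    moreover have "ereal (average d t) \<le> db"
    proof (cases db)
      case (real r)
      then have "C d t \<le> r" if "C \<in> space M" for C
        using random_feasible[OF that d] t by (auto simp: feasible_def)
      then have "average d t \<le> r"
        using t by (simp add: average_def) (intro integral_le_const int AE_I2)
      then show ?thesis
        by (simp add: real)
    qed (use db_pos in auto)
    ultimately show "ereal (average d t) \<le> min db (ereal (d t))"
      by simp
  qed
next
  fix d d' t
  assume d: "d \<in> D" and d': "d' \<in> D" and t: "t \<in> {1..T}" and eq: "\<forall>s\<in>{1..t}. d s = d' s"
  have "C d t = C d' t" if "C \<in> space M" for C
    using M that d d' t eq unfolding randomized_online_algorithm_def online_algorithm_def by blast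
  then have "(\<integral>C. C d t \<partial>M) = (\<integral>C. C d' t \<partial>M)"
    by (intro Bochner_Integration.integral_cong) auto
  then show "average d t = average d' t"
    using t by (simp add: average_def)
qed

text \<open>Jensen's inequality for the maximum: the expected remainder of each slot is at most the
  expected peak.\<close>

lemma peak_average_le:
  assumes "d \<in> D"
  shows "peak T d (average d) \<le> (\<integral>C. peak T d (C d) \<partial>M)"
  unfolding peak_le_iff[OF T_pos]
proof
  fix t assume t: "t \<in> {1..T}"
  note int = integrable_decision[OF assms t]
  have "d t - average d t = (\<integral>C. d t - C d t \<partial>M)"
    using int t by (simp add: average_def prob_space)
  also have "\<dots> \<le> (\<integral>C. peak T d (C d) \<partial>M)"
    using int integrable_peak[OF assms] diff_le_peak[OF t]
    by (intro integral_mono) auto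
  finally show "d t - average d t \<le> (\<integral>C. peak T d (C d) \<partial>M)" .
qed

lemma expected_peak_le:
  assumes "d \<in> D"
  shows "(\<integral>C. peak T d (C d) \<partial>M) \<le> randomized_comp_ratio T c db dl du M * v d"
proof -
  \<comment> \<open>Boundedness ensures that the real supremum of the ratios is an upper bound for
    each of them.\<close>
  have "bdd_above ((\<lambda>d. (\<integral>C. peak T d (C d) \<partial>M) / v d) ` D)"
  proof (rule bdd_aboveI2)
    fix d assume d: "d \<in> D"
    have "(\<integral>C. peak T d (C d) \<partial>M) \<le> du"
      using random_peak_bounds[OF _ d]
      by (intro integral_le_const integrable_peak d AE_I2)
    then show "(\<integral>C. peak T d (C d) \<partial>M) / v d \<le> du / v_low"
      using opt_val_ge[OF d] v_low_pos dl_pos dl_le_du by (intro frac_le) auto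
  qed
  from cSUP_upper[OF assms this]
  have "(\<integral>C. peak T d (C d) \<partial>M) / v d \<le> randomized_comp_ratio T c db dl du M"
    by (simp add: randomized_comp_ratio_def)
  then show ?thesis
    using opt_val_pos[OF assms] by (simp add: field_simps)
qed

text \<open>A smaller ratio would have \<open>\<Phi>\<close> above \<open>c\<close> by strict
  decrease, whereas the averaged algorithm meets that ratio and so forces \<open>\<Phi>\<close>
  there to be at most \<open>c\<close>.\<close>

lemma randomized_comp_ratio_ge:
  assumes "\<Phi> \<pi> = c"
  shows "\<pi> \<le> randomized_comp_ratio T c db dl du M"
proof (rule ccontr)
  assume "\<not> \<pi> \<le> randomized_comp_ratio T c db dl du M"
  then have "c < \<Phi> (randomized_comp_ratio T c db dl du M)"
    using Phi_less[of "randomized_comp_ratio T c db dl du M" \<pi>] assms c_pos by simp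
  moreover have "\<Phi> (randomized_comp_ratio T c db dl du M) \<le> c"
    using peak_average_le expected_peak_le
    by (intro Phi_le_capacity[OF online_average]) (rule order_trans)
  ultimately show False
    by simp
qed

end

text \<open>The point mass at \<open>C\<close> is a randomized algorithm whose expected peaks are
  the peaks of \<open>C\<close>, so the randomized bound applies.\<close>

lemma comp_ratio_ge:
  assumes "online C" "\<Phi> \<pi> = c"
  shows "\<pi> \<le> comp_ratio T c db dl du C"
proof -
  let ?M = "return (count_space {C}) C"
  have "prob_space ?M"
    by (rule prob_space_return) simp
  then have "randomized_online_algorithm T c db dl du ?M"
    using assms(1) by (simp add: randomized_online_algorithm_def)
  from randomized_comp_ratio_ge[OF this assms(2)] show ?thesis
    by (simp add: randomized_comp_ratio_def comp_ratio_def integral_return)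
qed

end

theorem theorem4p5:
  fixes T :: nat and c dl du :: real and db :: ereal
  assumes parameters: "pmd_parameters T c db dl du"
    and nondegenerate: "c \<noteq> real T * dl" "ereal c \<le> ereal (real T) * db"
  shows "(\<exists>!\<pi>. 1 \<le> \<pi> \<and> Phi T c db dl du \<pi> = c) \<and>
    (\<forall>\<pi>. 1 \<le> \<pi> \<and> Phi T c db dl du \<pi> = c \<longrightarrow>
       online_algorithm T c db dl du (pCR_PMD T c db dl \<pi>) \<and>
       comp_ratio T c db dl du (pCR_PMD T c db dl \<pi>) = \<pi> \<and>
       (\<forall>C. online_algorithm T c db dl du C \<longrightarrow>
          \<not> comp_ratio T c db dl du C < \<pi>) \<and>
       (\<forall>M. randomized_online_algorithm T c db dl du M \<longrightarrow>
          \<not> randomized_comp_ratio T c db dl du M < \<pi>))"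
proof -
  interpret pmd T c dl du db
    using assms by unfold_locales (auto simp: pmd_parameters_def)
  \<comment> \<open>The peak guarantee gives one inequality; the other is the general lower bound
    applied to the online algorithm \<open>alg \<pi>\<close> itself.\<close>
  have "comp_ratio T c db dl du (alg \<pi>) = \<pi>" if "1 \<le> \<pi>" "\<Phi> \<pi> = c" for \<pi>
    using comp_ratio_pCR_PMD_le[of \<pi>] comp_ratio_ge[OF online_pCR_PMD[OF that] that(2)] that
    by simp
  then show ?thesis
    using ex1_Phi_eq online_pCR_PMD comp_ratio_ge randomized_comp_ratio_ge
    by (simp add: not_less)
qed

end
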